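(* Let $\mathbb{U}$ be a monster model of $\operatorname{Th}(\mathcal{U})$. Fix small $B,C\subset\mathbb{U}$ and a singleton $b_*\in\mathbb{U}$. For any small $A\subset\mathbb{U}$, if $A\mathop{\smile\!\!\!\!\!\mid}^d_C B$, then there is $A'\equiv_C A$ such that $A'\mathop{\smile\!\!\!\!\!\mid}^d_C Bb_*$.
   Context: $\mathcal{U}$ is the Urysohn sphere (the unique complete separable metric space of diameter 1 that is ultrahomogeneous and universal for separable metric spaces of diameter $\le1$), in continuous logic with only the metric; $\mathbb{U}$ a sufficiently saturated model; small means $\mathbb{U}$ is $\chi(\cdot)^+$-saturated over the set. $A'\equiv_C A$ means same type over $C$. A formula $\varphi(\bar x,\bar b)$ divides over $C$ if there are $(\bar b^l)_{l<\omega}$ with $\bar b^l\equiv_C\bar b$, $\epsilon>0$, $k>0$ such that every $k$-element subset of $\{\max(\varphi(\bar x,\bar b^l)-\epsilon,0)=0:l<\omega\}$ is unsatisfiable; a partial type divides over $C$ if it forces $\varphi=0$ for some $\varphi$ dividing over $C$. $A\mathop{\smile\!\!\!\!\!\mid}^d_C B$ means $\operatorname{tp}(A/BC)$ does not divide over $C$. *)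

theory Defs
  imports "HOL-Analysis.Analysis"
begin

section \<open>Continuous logic in the language of the metric\<close>

text \<open>A structure is a type of class \<^class>\<open>complete_space\<close> whose distances are at most 1.\<close>

definition metric_structure :: "'m::complete_space itself \<Rightarrow> bool" where
  "metric_structure _ \<longleftrightarrow> (\<forall>x y :: 'm. dist x y \<le> 1)"

datatype 'v fmla =
    Dist 'v 'v
  | Conn "(nat \<Rightarrow> real) \<Rightarrow> real" "'v fmla list"
  | SupQ 'v "'v fmla"
  | InfQ 'v "'v fmla"

text \<open>The connectives of arity \<open>n\<close> are all the continuous maps from \<open>[0,1]\<^sup>n\<close> to \<open>[0,1]\<close>.\<close>

definition connective :: "nat \<Rightarrow> ((nat \<Rightarrow> real) \<Rightarrow> real) \<Rightarrow> bool" where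
  "connective n u \<longleftrightarrow>
     continuous_map (product_topology (\<lambda>_. top_of_set {0..1}) {..<n}) (top_of_set {0..1}) u"

fun wf_fmla :: "'v fmla \<Rightarrow> bool" where
  "wf_fmla (Dist x y) \<longleftrightarrow> True"
| "wf_fmla (Conn u \<phi>s) \<longleftrightarrow> connective (length \<phi>s) u \<and> (\<forall>\<phi>\<in>set \<phi>s. wf_fmla \<phi>)"
| "wf_fmla (SupQ x \<phi>) \<longleftrightarrow> wf_fmla \<phi>"
| "wf_fmla (InfQ x \<phi>) \<longleftrightarrow> wf_fmla \<phi>"

fun FV :: "'v fmla \<Rightarrow> 'v set" where
  "FV (Dist x y) = {x, y}"
| "FV (Conn u \<phi>s) = (\<Union>\<phi>\<in>set \<phi>s. FV \<phi>)"
| "FV (SupQ x \<phi>) = FV \<phi> - {x}"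
| "FV (InfQ x \<phi>) = FV \<phi> - {x}"

fun eval :: "'v fmla \<Rightarrow> ('v \<Rightarrow> 'm::complete_space) \<Rightarrow> real" where
  "eval (Dist x y) v = dist (v x) (v y)"
| "eval (Conn u \<phi>s) v = u (\<lambda>i\<in>{..<length \<phi>s}. map (\<lambda>\<phi>. eval \<phi> v) \<phi>s ! i)"
| "eval (SupQ x \<phi>) v = (SUP m. eval \<phi> (v(x := m)))"
| "eval (InfQ x \<phi>) v = (INF m. eval \<phi> (v(x := m)))"

definition sentence :: "nat fmla \<Rightarrow> bool" where
  "sentence \<sigma> \<longleftrightarrow> wf_fmla \<sigma> \<and> FV \<sigma> = {}"

definition satisfies :: "'m::complete_space itself \<Rightarrow> nat fmla \<Rightarrow> bool" where
  "satisfies _ \<sigma> \<longleftrightarrow> (\<forall>v :: nat \<Rightarrow> 'm. eval \<sigma> v = 0)"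

definition Th :: "'m::complete_space itself \<Rightarrow> nat fmla set" where
  "Th M = {\<sigma>. sentence \<sigma> \<and> satisfies M \<sigma>}"

definition is_model :: "'m::complete_space itself \<Rightarrow> nat fmla set \<Rightarrow> bool" where
  "is_model M T \<longleftrightarrow> metric_structure M \<and> (\<forall>\<sigma>\<in>T. satisfies M \<sigma>)"


section \<open>Formulas with parameters, types, saturation\<close>

text \<open>
  A pair \<open>(\<phi>, b)\<close> stands for the formula \<open>\<phi>(x, b)\<close>: the variables \<open>Inl i\<close> are the
  object variables \<open>x\<^sub>i\<close>, and a free variable \<open>Inr n\<close> is replaced by the parameter \<open>b n\<close>.
  Where a set of conditions is meant, \<open>(\<phi>, b)\<close> stands for the condition \<open>\<phi>(x, b) = 0\<close>.
\<close>

type_synonym ('i, 'm) pfmla = "('i + nat) fmla \<times> (nat \<Rightarrow> 'm)"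

definition param_vars :: "('i + nat) fmla \<Rightarrow> nat set" where
  "param_vars \<phi> = {n. Inr n \<in> FV \<phi>}"

definition fmlas_over :: "'i set \<Rightarrow> 'm set \<Rightarrow> ('i, 'm) pfmla set" where
  "fmlas_over I C =
     {(\<phi>, b). wf_fmla \<phi> \<and> (\<forall>i. Inl i \<in> FV \<phi> \<longrightarrow> i \<in> I) \<and> (\<forall>n\<in>param_vars \<phi>. b n \<in> C)}"

definition pval :: "('i, 'm::complete_space) pfmla \<Rightarrow> ('i \<Rightarrow> 'm) \<Rightarrow> real" where
  "pval \<psi> a = eval (fst \<psi>) (case_sum a (snd \<psi>))"

definition realizes :: "('i \<Rightarrow> 'm::complete_space) \<Rightarrow> ('i, 'm) pfmla set \<Rightarrow> bool" where
  "realizes a \<pi> \<longleftrightarrow> (\<forall>\<psi>\<in>\<pi>. pval \<psi> a = 0)"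

text \<open>The type over \<open>C\<close> of the tuple \<open>a\<close> indexed by \<open>I\<close>.\<close>

definition tp :: "'i set \<Rightarrow> ('i \<Rightarrow> 'm::complete_space) \<Rightarrow> 'm set \<Rightarrow> ('i, 'm) pfmla set" where
  "tp I a C = {\<psi> \<in> fmlas_over I C. pval \<psi> a = 0}"

context includes cardinal_syntax
begin

definition saturated :: "'m::complete_space itself \<Rightarrow> 'k rel \<Rightarrow> bool" where
  "saturated _ \<kappa> \<longleftrightarrow>
     (\<forall>(D :: 'm set) (n :: nat) \<Gamma>.
        |D| <o \<kappa> \<longrightarrow>
        \<Gamma> \<subseteq> fmlas_over {..<n} D \<longrightarrow>
        (\<forall>\<Gamma>\<^sub>0 \<subseteq> \<Gamma>. finite \<Gamma>\<^sub>0 \<longrightarrow> (\<exists>a. realizes a \<Gamma>\<^sub>0)) \<longrightarrow>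
        (\<exists>a. realizes a \<Gamma>))"

definition dense_in :: "'a::topological_space set \<Rightarrow> 'a set \<Rightarrow> bool" where
  "dense_in D A \<longleftrightarrow> D \<subseteq> A \<and> A \<subseteq> closure D"

definition density_character :: "'a::topological_space set \<Rightarrow> 'a rel" where
  "density_character A =
     card_of (SOME D. dense_in D A \<and> (\<forall>E. dense_in E A \<longrightarrow> |D| \<le>o |E| ))"

end

definition small :: "'m::complete_space set \<Rightarrow> bool" where
  "small A \<longleftrightarrow> saturated TYPE('m) (cardSuc (density_character A))"

text \<open>
  ``Sufficiently saturated'' is read as \<open>\<aleph>\<^sub>1\<close>-saturated; how much more saturation is
  needed is expressed by \<^const>\<open>small\<close>. In particular all separable sets are small.
\<close>

definition monster_model :: "'m::complete_space itself \<Rightarrow> nat fmla set \<Rightarrow> bool" where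
  "monster_model M T \<longleftrightarrow> is_model M T \<and> saturated M (cardSuc natLeq)"

text \<open>\<open>A' \<equiv>\<^sub>C A\<close>, with respect to some enumeration \<open>f\<close> of \<open>A'\<close> by \<open>A\<close>.\<close>

definition equiv_over :: "'m::complete_space set \<Rightarrow> 'm set \<Rightarrow> 'm set \<Rightarrow> bool" where
  "equiv_over C A' A \<longleftrightarrow> (\<exists>f. f ` A = A' \<and> tp A f C = tp A (\<lambda>x. x) C)"


section \<open>Dividing\<close>

text \<open>
  The members of the family of conditions are indexed by \<open>l\<close>, so that repetitions among
  the \<open>b\<^sup>l\<close> count. Satisfiability and forcing refer to the (monster) model
  given by the type \<open>'m\<close>.
\<close>

definition divides_fmla :: "'m::complete_space set \<Rightarrow> ('i, 'm) pfmla \<Rightarrow> bool" where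
  "divides_fmla C \<psi> \<longleftrightarrow> (case \<psi> of (\<phi>, b) \<Rightarrow>
     (\<exists>(bs :: nat \<Rightarrow> nat \<Rightarrow> 'm) (\<epsilon> :: real) (k :: nat).
        (\<forall>l. tp (param_vars \<phi>) (bs l) C = tp (param_vars \<phi>) b C) \<and> \<epsilon> > 0 \<and> k > 0 \<and>
        (\<forall>K. finite K \<and> card K = k \<longrightarrow>
           \<not> (\<exists>a. \<forall>l\<in>K. max (pval (\<phi>, bs l) a - \<epsilon>) 0 = 0))))"

definition forces :: "('i, 'm::complete_space) pfmla set \<Rightarrow> ('i, 'm) pfmla \<Rightarrow> bool" where
  "forces \<pi> \<psi> \<longleftrightarrow> (\<forall>a. realizes a \<pi> \<longrightarrow> pval \<psi> a = 0)"

definition divides_type ::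
  "'i set \<Rightarrow> 'm::complete_space set \<Rightarrow> ('i, 'm) pfmla set \<Rightarrow> bool" where
  "divides_type I C \<pi> \<longleftrightarrow> (\<exists>\<psi>\<in>fmlas_over I UNIV. divides_fmla C \<psi> \<and> forces \<pi> \<psi>)"

definition d_indep :: "'m::complete_space set \<Rightarrow> 'm set \<Rightarrow> 'm set \<Rightarrow> bool" where
  "d_indep A C B \<longleftrightarrow> \<not> divides_type A C (tp A (\<lambda>x. x) (B \<union> C))"


section \<open>The Urysohn sphere\<close>

definition ultrahomogeneous :: "'u::metric_space itself \<Rightarrow> bool" where
  "ultrahomogeneous _ \<longleftrightarrow>
     (\<forall>(F :: 'u set) (f :: 'u \<Rightarrow> 'u).
        finite F \<and> (\<forall>x\<in>F. \<forall>y\<in>F. dist (f x) (f y) = dist x y) \<longrightarrow>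
        (\<exists>g. bij g \<and> (\<forall>x y. dist (g x) (g y) = dist x y) \<and> (\<forall>x\<in>F. g x = f x)))"

text \<open>
  A separable metric space has at most the cardinality of the continuum, so up to isometry
  all of them have a set of reals as their carrier (\<open>d\<close> is an arbitrary metric on it).
\<close>

definition universal_for_separable :: "'u::metric_space itself \<Rightarrow> bool" where
  "universal_for_separable _ \<longleftrightarrow>
     (\<forall>(X :: real set) d.
        Metric_space X d \<and>
        separable_space (Metric_space.mtopology X d) \<and>
        (\<forall>x\<in>X. \<forall>y\<in>X. d x y \<le> 1) \<longrightarrow>
        (\<exists>f :: real \<Rightarrow> 'u. \<forall>x\<in>X. \<forall>y\<in>X. dist (f x) (f y) = d x y))"

definition urysohn_sphere :: "'u::complete_space itself \<Rightarrow> bool" where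
  "urysohn_sphere U \<longleftrightarrow>
     separable_space (euclidean :: 'u topology) \<and>
     bounded (UNIV :: 'u set) \<and> diameter (UNIV :: 'u set) = 1 \<and>
     ultrahomogeneous U \<and> universal_for_separable U"

end

theory Submission
  imports Defs "HOL-Library.Countable_Set_Type"
begin

text \<open>
  In a saturated model of the theory of the Urysohn sphere every one-point metric extension over
  a small set is realised, so types are determined by distances. Hence \<open>A\<close> has a copy \<open>A'\<close> over
  \<open>C\<close> that is freely amalgamated with \<open>B b\<^sub>*\<close> over \<open>C\<close>, i.e. at the largest distances that \<open>C\<close>
  and the diameter bound allow. Such a copy is always independent: if a formula \<open>\<phi>(x, b)\<close> forced
  by its type divided along \<open>(b\<^sup>l)\<^sub>l\<close>, then a copy of \<open>A\<close> that is also free over \<open>b\<close> would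
  satisfy \<open>\<phi>(x, b)\<close>, and a copy free over \<open>b\<^sup>0, \<dots>, b\<^sup>k\<^sup>-\<^sup>1\<close> would satisfy all the
  \<open>\<phi>(x, b\<^sup>l)\<close>, because free distances to \<open>b\<^sup>l\<close> depend only on the type of \<open>b\<^sup>l\<close> over \<open>C\<close>.
\<close>

section \<open>One-point extensions in the Urysohn sphere\<close>

text \<open>The graph of a Katetov function bounded by 1: each point \<open>p\<close> with its
  prescribed distance \<open>v\<close> to a new point. A relation spares choosing representatives
  when points come as tuples with repetitions; the case \<open>p = q\<close> makes it single-valued
  and nonnegative.\<close>

definition katetov :: "('a::metric_space \<times> real) set \<Rightarrow> bool" where
  "katetov R \<longleftrightarrow>
     (\<forall>(p, v)\<in>R. v \<le> 1 \<and> (\<forall>(q, w)\<in>R. \<bar>v - w\<bar> \<le> dist p q \<and> dist p q \<le> v + w))"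

lemma katetovI:
  assumes "\<And>p v. (p, v) \<in> R \<Longrightarrow> v \<le> 1"
    and "\<And>p v q w. (p, v) \<in> R \<Longrightarrow> (q, w) \<in> R \<Longrightarrow> v \<le> w + dist p q"
    and "\<And>p v q w. (p, v) \<in> R \<Longrightarrow> (q, w) \<in> R \<Longrightarrow> dist p q \<le> v + w"
  shows "katetov R"
  unfolding katetov_def using assms(1) assms(3)
  by (auto simp: abs_le_iff intro: assms(2)) (use assms(2) in \<open>fastforce simp: dist_commute\<close>)+

lemma katetovD:
  assumes "katetov R" "(p, v) \<in> R" "(q, w) \<in> R"
  shows "v \<le> w + dist p q" "w \<le> v + dist p q" "dist p q \<le> v + w"
proof -
  have "\<bar>v - w\<bar> \<le> dist p q \<and> dist p q \<le> v + w"
    using assms unfolding katetov_def by fast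
  then show "v \<le> w + dist p q" "w \<le> v + dist p q" "dist p q \<le> v + w" by auto
qed

lemma katetov_le_1: "katetov R \<Longrightarrow> (p, v) \<in> R \<Longrightarrow> v \<le> 1"
  unfolding katetov_def by fast

lemma katetov_ge_0: "katetov R \<Longrightarrow> (p, v) \<in> R \<Longrightarrow> 0 \<le> v"
  using katetovD(3)[of R p v p v] by simp

lemma katetov_subset: "katetov R \<Longrightarrow> S \<subseteq> R \<Longrightarrow> katetov S"
  unfolding katetov_def by fast

lemma katetov_realized_zero:
  assumes "katetov R" "(p, 0) \<in> R" "(q, w) \<in> R"
  shows "dist p q = w"
  using katetovD[OF assms] by simp

lemma urysohn_sphere_dist_le_1:
  fixes x y :: "'u::complete_space"
  assumes "urysohn_sphere TYPE('u)"
  shows "dist x y \<le> 1"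
  using assms diameter_bounded_bound[of "UNIV :: 'u set" x y]
  by (simp add: urysohn_sphere_def)

text \<open>The absolute values make this nonnegative for every \<open>g\<close>, as
  \<open>Metric_space\<close> demands even outside its carrier.\<close>

fun one_point_dist :: "('a::metric_space \<Rightarrow> real) \<Rightarrow> 'a option \<Rightarrow> 'a option \<Rightarrow> real" where
  "one_point_dist g None None = 0"
| "one_point_dist g (Some p) None = \<bar>g p\<bar>"
| "one_point_dist g None (Some p) = \<bar>g p\<bar>"
| "one_point_dist g (Some p) (Some q) = dist p q"

text \<open>Adjoining the new point to the finitely many given ones yields a finite metric space.
  Universality embeds it, and ultrahomogeneity carries the embedded copy of the old points back to
  the originals.\<close>

lemma urysohn_sphere_one_point:
  fixes R :: "('u::complete_space \<times> real) set"
  assumes U: "urysohn_sphere TYPE('u)" and fin: "finite R" and R: "katetov R"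
  shows "\<exists>m. \<forall>(p, v)\<in>R. dist m p = v"
proof (cases "\<exists>p. (p, 0) \<in> R")
  \<comment> \<open>A prescribed distance 0 would make the adjoined point coincide with an old one;
    that old point is then the answer.\<close>
  case True
  then show ?thesis using katetov_realized_zero[OF R] by fast
next
  case False
  define F where "F = fst ` R"
  define g where "g p = (SOME v. (p, v) \<in> R)" for p
  have gR: "(p, g p) \<in> R" if "p \<in> F" for p
    using that unfolding F_def g_def by (auto intro: someI)
  have gv: "g p = v" if "(p, v) \<in> R" for p v
  proof -
    have "(p, g p) \<in> R" using that gR unfolding F_def by force
    then show ?thesis using katetovD[OF R that, of p "g p"] by simp
  qed
  have gpos: "0 < g p" if "p \<in> F" for p
    using katetov_ge_0[OF R gR[OF that]] False gR[OF that] by (cases "g p = 0") auto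
  have gl: "g p \<le> g q + dist p q" "dist p q \<le> g p + g q" if "p \<in> F" "q \<in> F" for p q
    using katetovD[OF R gR[OF that(1)] gR[OF that(2)]] by auto
  have finF: "finite (insert None (Some ` F))" using fin by (simp add: F_def)
  \<comment> \<open>Universality is formulated for carriers of reals, so the finite space, with
    \<open>None\<close> as its new point, is coded injectively by reals.\<close>
  obtain h :: "'u option \<Rightarrow> nat" where h: "inj_on h (insert None (Some ` F))"
    using finite_imp_inj_to_nat_seg[OF finF] by blast
  define e where "e = real \<circ> h"
  have e: "inj_on e (insert None (Some ` F))"
    unfolding e_def using h by (intro comp_inj_on) (auto simp: inj_on_def)
  define X where "X = e ` insert None (Some ` F)"
  define k where "k = inv_into (insert None (Some ` F)) e"
  define d where "d x y = one_point_dist g (k x) (k y)" for x y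
  have ke': "k (e z) = z" if "z \<in> insert None (Some ` F)" for z
    unfolding k_def using e that by (rule inv_into_f_f)
  have ke: "k (e None) = None" "\<And>p. p \<in> F \<Longrightarrow> k (e (Some p)) = Some p"
    using ke' by auto
  have "Metric_space X d"
  proof
    fix x y show "0 \<le> d x y" unfolding d_def
      by (cases "k x"; cases "k y") auto
  next
    fix x y show "d x y = d y x" unfolding d_def
      by (cases "k x"; cases "k y") (auto simp: dist_commute)
  next
    fix x y assume "x \<in> X" "y \<in> X"
    then show "d x y = 0 \<longleftrightarrow> x = y"
      by (auto simp: X_def d_def ke) (use gpos in fastforce)+
  next
    fix x y z assume "x \<in> X" "y \<in> X" "z \<in> X"
    then obtain a b c where abc: "x = e a" "y = e b" "z = e c" "{a, b, c} \<subseteq> insert None (Some ` F)"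
      unfolding X_def by blast
    have "g p \<le> dist p q + g q" "g p \<le> g q + dist q p" "dist p q \<le> g p + g q" "\<bar>g p\<bar> = g p"
      if "p \<in> F" "q \<in> F" for p q
      using gl[OF that] gpos[OF that(1)] by (auto simp: dist_commute)
    then have "one_point_dist g a c \<le> one_point_dist g a b + one_point_dist g b c"
      using abc(4) by (cases a; cases b; cases c) (auto simp: dist_triangle)
    then show "d x z \<le> d x y + d y z" using abc ke' by (simp add: d_def)
  qed
  moreover have "finite X" using finF by (simp add: X_def)
  moreover have "separable_space (Metric_space.mtopology X d)"
    unfolding separable_space_def
  proof (intro exI[of _ X] conjI)
    show "countable X" using \<open>finite X\<close> by (rule countable_finite)
    have t: "topspace (Metric_space.mtopology X d) = X"
      using calculation(1) by (rule Metric_space.topspace_mtopology)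
    then show "X \<subseteq> topspace (Metric_space.mtopology X d)" by simp
    show "Metric_space.mtopology X d closure_of X = topspace (Metric_space.mtopology X d)"
      using t by (metis closure_of_topspace)
  qed
  moreover have "\<forall>x\<in>X. \<forall>y\<in>X. d x y \<le> 1"
    using urysohn_sphere_dist_le_1[OF U] gpos katetov_le_1[OF R gR]
    by (auto simp: X_def d_def ke abs_of_pos)
  ultimately obtain f :: "real \<Rightarrow> 'u" where f: "\<forall>x\<in>X. \<forall>y\<in>X. dist (f x) (f y) = d x y"
    using U unfolding urysohn_sphere_def universal_for_separable_def by blast
  have "\<forall>x\<in>F. \<forall>y\<in>F. dist (f (e (Some x))) (f (e (Some y))) = dist x y"
    using f by (auto simp: X_def d_def ke)
  then obtain \<sigma> :: "'u \<Rightarrow> 'u" where \<sigma>: "bij \<sigma>" "\<forall>x y. dist (\<sigma> x) (\<sigma> y) = dist x y"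
      "\<forall>x\<in>F. \<sigma> x = f (e (Some x))"
    using U fin unfolding urysohn_sphere_def ultrahomogeneous_def F_def
    by (elim conjE allE[of _ "fst ` R"] allE[of _ "\<lambda>x. f (e (Some x))"]) auto
  obtain m where m: "\<sigma> m = f (e None)" using \<sigma>(1) by (metis bij_pointE)
  have "dist m p = v" if "(p, v) \<in> R" for p v
  proof -
    have p: "p \<in> F" using that by (force simp: F_def)
    have "dist m p = dist (\<sigma> m) (\<sigma> p)" using \<sigma> by simp
    also have "\<dots> = d (e None) (e (Some p))" using f m \<sigma>(3) p by (auto simp: X_def)
    also have "\<dots> = v" using p gpos[OF p] gv[OF that] by (simp add: d_def ke)
    finally show ?thesis .
  qed
  then show ?thesis by blast
qed

text \<open>
  Allowing an error of this size in the extension property turns a statement about Katetov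
  functions, which first-order continuous logic cannot assume, into one about all tuples, and
  hence into a sentence.
\<close>

definition katetov_defect :: "nat \<Rightarrow> (nat \<Rightarrow> real) \<Rightarrow> (nat \<Rightarrow> nat \<Rightarrow> real) \<Rightarrow> real" where
  "katetov_defect n v d = (\<Sum>i<n. \<Sum>j<n. max 0 (\<bar>v i - v j\<bar> - d i j) + max 0 (d i j - v i - v j))"

lemma katetov_defect_ge:
  assumes "i < n" "j < n"
  shows "\<bar>v i - v j\<bar> \<le> d i j + katetov_defect n v d" "d i j \<le> v i + v j + katetov_defect n v d"
proof -
  let ?t = "\<lambda>i j. max 0 (\<bar>v i - v j\<bar> - d i j) + max 0 (d i j - v i - v j)"
  have "?t i j \<le> (\<Sum>j<n. ?t i j)"
    using assms by (intro member_le_sum) auto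
  also have "\<dots> \<le> katetov_defect n v d"
    unfolding katetov_defect_def using assms
    by (intro member_le_sum[of i "{..<n}" "\<lambda>i. \<Sum>j<n. ?t i j"] sum_nonneg) auto
  finally show "\<bar>v i - v j\<bar> \<le> d i j + katetov_defect n v d"
    "d i j \<le> v i + v j + katetov_defect n v d" by linarith+
qed

lemma katetov_defect_nonneg: "0 \<le> katetov_defect n v d"
  unfolding katetov_defect_def by (intro sum_nonneg) auto

text \<open>Raising the values by half the defect, capped at 1, repairs
  \<open>dist p q \<le> v + w\<close>; passing to the largest 1-Lipschitz function below the result
  repairs the Lipschitz condition without destroying the first. Together the changes stay within the
  defect.\<close>

lemma urysohn_sphere_approx_one_point:
  fixes x :: "nat \<Rightarrow> 'u::complete_space"
  assumes U: "urysohn_sphere TYPE('u)" and v: "\<And>i. i < n \<Longrightarrow> 0 \<le> v i \<and> v i \<le> 1"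
  shows "\<exists>m. \<forall>i<n. \<bar>dist m (x i) - v i\<bar> \<le> katetov_defect n v (\<lambda>i j. dist (x i) (x j))"
proof (cases "n = 0")
  case False
  define \<delta> where "\<delta> = katetov_defect n v (\<lambda>i j. dist (x i) (x j))"
  define h where "h i = min 1 (v i + \<delta> / 2)" for i
  define k where "k i = Min ((\<lambda>j. h j + dist (x i) (x j)) ` {..<n})" for i
  have \<delta>0: "0 \<le> \<delta>" unfolding \<delta>_def by (rule katetov_defect_nonneg)
  have \<delta>: "v i \<le> v j + dist (x i) (x j) + \<delta>" "dist (x i) (x j) \<le> v i + v j + \<delta>" if "i < n" "j < n" for i j
    using katetov_defect_ge[OF that, where v = v and d = "\<lambda>i j. dist (x i) (x j)"] unfolding \<delta>_def by linarith+
  have hh: "dist (x i) (x j) \<le> h i + h j" if "i < n" "j < n" for i j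
    using \<delta>(2)[OF that] v[OF that(1)] v[OF that(2)] \<delta>0 urysohn_sphere_dist_le_1[OF U, of "x i" "x j"]
    unfolding h_def by (auto simp: min_def)
  have kle: "k i \<le> h j + dist (x i) (x j)" if "j < n" for i j
    unfolding k_def using that by (intro Min_le) auto
  have kat: "\<exists>j<n. k i = h j + dist (x i) (x j)" for i
  proof -
    have "k i \<in> (\<lambda>j. h j + dist (x i) (x j)) ` {..<n}"
      unfolding k_def using False by (intro Min_in) auto
    then show ?thesis by auto
  qed
  have kh: "k i \<le> h i" if "i < n" for i using kle[OF that, of i] by simp
  have "katetov ((\<lambda>i. (x i, k i)) ` {..<n})"
  proof (rule katetovI)
    fix p a assume "(p, a) \<in> (\<lambda>i. (x i, k i)) ` {..<n}"
    then obtain i where i: "i < n" "p = x i" "a = k i" by auto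
    show "a \<le> 1" using kh[of i] i by (auto simp: h_def)
    fix q b assume "(q, b) \<in> (\<lambda>i. (x i, k i)) ` {..<n}"
    then obtain j where j: "j < n" "q = x j" "b = k j" by auto
    obtain s where s: "s < n" "k i = h s + dist (x i) (x s)" using kat by blast
    obtain t where t: "t < n" "k j = h t + dist (x j) (x t)" using kat by blast
    show "a \<le> b + dist p q"
      using kle[of t i] t i j dist_triangle[of "x i" "x t" "x j"] by auto
    show "dist p q \<le> a + b"
      using hh[of s t] s t i j dist_triangle[of "x i" "x j" "x s"] dist_triangle[of "x s" "x j" "x t"]
      by (auto simp: dist_commute)
  qed
  then obtain m where m: "\<forall>(p, a)\<in>(\<lambda>i. (x i, k i)) ` {..<n}. dist m p = a"
    using urysohn_sphere_one_point[OF U] by (metis finite_imageI finite_lessThan)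
  have "\<bar>dist m (x i) - v i\<bar> \<le> \<delta>" if "i < n" for i
  proof -
    obtain j where j: "j < n" "k i = h j + dist (x i) (x j)" using kat by blast
    have "v i - \<delta> \<le> k i"
      using j \<delta>(1)[OF that j(1)] v[OF that] \<delta>0 zero_le_dist[of "x i" "x j"] unfolding h_def by linarith
    moreover have "k i \<le> v i + \<delta>" using kh[OF that] \<delta>0 by (auto simp: h_def)
    moreover have "dist m (x i) = k i" using m that by auto
    ultimately show ?thesis by linarith
  qed
  then show ?thesis unfolding \<delta>_def by blast
qed simp

section \<open>Evaluation of formulas\<close>

lemma eval_bounds:
  fixes v :: "'v \<Rightarrow> 'm::complete_space"
  assumes M: "metric_structure TYPE('m)"
  shows "wf_fmla \<phi> \<Longrightarrow> 0 \<le> eval \<phi> v \<and> eval \<phi> v \<le> 1"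
proof (induction \<phi> arbitrary: v)
  case (Dist x y)
  then show ?case using M by (simp add: metric_structure_def)
next
  case (Conn u \<phi>s)
  have "(\<lambda>i\<in>{..<length \<phi>s}. map (\<lambda>\<phi>. eval \<phi> v) \<phi>s ! i) \<in> (\<Pi>\<^sub>E i\<in>{..<length \<phi>s}. {0..1})"
    using Conn by (auto simp: PiE_def Pi_def)
  then have "u (\<lambda>i\<in>{..<length \<phi>s}. map (\<lambda>\<phi>. eval \<phi> v) \<phi>s ! i) \<in> {0..1}"
    using Conn.prems unfolding wf_fmla.simps connective_def continuous_map_def
    by (auto simp: Pi_def)
  then show ?case by simp
next
  case (SupQ x \<phi>)
  have *: "0 \<le> eval \<phi> w \<and> eval \<phi> w \<le> 1" for w :: "'v \<Rightarrow> 'm"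
    using SupQ.IH[of w] SupQ.prems by simp
  have "0 \<le> eval \<phi> (v(x := undefined))" using * by simp
  also have "\<dots> \<le> eval (SupQ x \<phi>) v"
    unfolding eval.simps by (rule cSUP_upper) (use * in \<open>auto intro!: bdd_aboveI[of _ 1]\<close>)
  finally show ?case using * by (auto intro!: cSUP_least)
next
  case (InfQ x \<phi>)
  have *: "0 \<le> eval \<phi> w \<and> eval \<phi> w \<le> 1" for w :: "'v \<Rightarrow> 'm"
    using InfQ.IH[of w] InfQ.prems by simp
  have "eval (InfQ x \<phi>) v \<le> eval \<phi> (v(x := undefined))"
    unfolding eval.simps by (rule cINF_lower) (use * in \<open>auto intro!: bdd_belowI[of _ 0]\<close>)
  also have "\<dots> \<le> 1" using * by simp
  finally show ?case using * by (auto intro!: cINF_greatest)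
qed

text \<open>Values are nonnegative, so a supremum vanishes only if every value does:
  \<open>SupQ\<close> acts as a universal quantifier.\<close>

lemma satisfies_SupQ_iff:
  assumes M: "metric_structure TYPE('m::complete_space)" and wf: "wf_fmla \<phi>"
  shows "satisfies TYPE('m) (SupQ x \<phi>) \<longleftrightarrow> satisfies TYPE('m) \<phi>"
proof
  assume s: "satisfies TYPE('m) (SupQ x \<phi>)"
  have "eval \<phi> v = 0" for v :: "nat \<Rightarrow> 'm"
  proof -
    have "eval \<phi> (v(x := v x)) \<le> eval (SupQ x \<phi>) v"
      unfolding eval.simps
      by (rule cSUP_upper) (use eval_bounds[OF M wf] in \<open>auto intro!: bdd_aboveI[of _ 1]\<close>)
    then show ?thesis using s eval_bounds[OF M wf, of v] by (simp add: satisfies_def)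
  qed
  then show "satisfies TYPE('m) \<phi>" by (simp add: satisfies_def)
qed (simp add: satisfies_def)

lemma satisfies_foldr_SupQ_iff:
  assumes M: "metric_structure TYPE('m::complete_space)" and wf: "wf_fmla \<phi>"
  shows "wf_fmla (foldr SupQ xs \<phi>) \<and> (satisfies TYPE('m) (foldr SupQ xs \<phi>) \<longleftrightarrow> satisfies TYPE('m) \<phi>)"
  by (induction xs) (use wf in \<open>auto simp: satisfies_SupQ_iff[OF M]\<close>)

lemma FV_foldr_SupQ: "FV (foldr SupQ xs \<phi>) = FV \<phi> - set xs"
  by (induction xs) auto

text \<open>The infimum need not be attained, so \<open>InfQ\<close> is only an approximate
  existential quantifier; hence the \<open>\<epsilon>\<close>.\<close>

lemma satisfies_InfQ_iff:
  assumes M: "metric_structure TYPE('m::complete_space)" and wf: "wf_fmla \<phi>"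
  shows "satisfies TYPE('m) (InfQ x \<phi>) \<longleftrightarrow>
    (\<forall>(v :: nat \<Rightarrow> 'm) \<epsilon>. \<epsilon> > 0 \<longrightarrow> (\<exists>m. eval \<phi> (v(x := m)) < \<epsilon>))"
proof -
  have bdd: "bdd_below (range (\<lambda>m. eval \<phi> (v(x := m))))" for v :: "nat \<Rightarrow> 'm"
    using eval_bounds[OF M wf] by (auto intro!: bdd_belowI[of _ 0])
  have "0 \<le> (INF m. eval \<phi> (v(x := m)))" for v :: "nat \<Rightarrow> 'm"
    using eval_bounds[OF M wf] by (auto intro!: cINF_greatest)
  then have "(INF m. eval \<phi> (v(x := m))) = 0 \<longleftrightarrow> (\<forall>\<epsilon>>0. (INF m. eval \<phi> (v(x := m))) < \<epsilon>)"
    for v :: "nat \<Rightarrow> 'm"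
    by (metis order_le_less order_less_irrefl)
  then show ?thesis
    by (simp add: satisfies_def cINF_less_iff[OF _ bdd])
qed

section \<open>Sentences expressing the approximate extension property\<close>

lemma connective_clamp:
  assumes "continuous_map (product_topology (\<lambda>_. top_of_set {0..1}) {..<n}) euclideanreal h"
  shows "connective n (\<lambda>w. min 1 (max 0 (h w)))"
  unfolding connective_def continuous_map_in_subtopology
  by (auto intro!: continuous_intros assms)

lemma continuous_map_coordinate:
  assumes "i < n"
  shows "continuous_map (product_topology (\<lambda>_. top_of_set {0..1::real}) {..<n}) euclideanreal (\<lambda>w. w i)"
  using continuous_map_product_projection[of i "{..<n}" "\<lambda>_. top_of_set {0..1::real}"] assms
  by (simp add: continuous_map_in_subtopology)

lemma pair_index_less:
  fixes n :: nat
  assumes "i \<le> n" "j \<le> n"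
  shows "i * Suc n + j < Suc n * Suc n"
proof -
  have "i * Suc n + j < Suc i * Suc n" using assms by simp
  also have "\<dots> \<le> Suc n * Suc n" using assms by (intro mult_le_mono) auto
  finally show ?thesis .
qed

text \<open>Variable \<open>n\<close> is the new point, the variables below \<open>n\<close> are the
  given tuple. One connective acts on all \<open>Suc n * Suc n\<close> distances, the pair
  \<open>(i, j)\<close> sitting at position \<open>i * Suc n + j\<close>. The factor
  \<open>n\<close> on the defect accounts for the sum of \<open>n\<close> errors, each at most one
  defect.\<close>

definition ext_fmla :: "nat \<Rightarrow> (nat \<Rightarrow> real) \<Rightarrow> nat fmla" where
  "ext_fmla n v = Conn
     (\<lambda>w. min 1 (max 0 ((\<Sum>i<n. \<bar>w (n * Suc n + i) - v i\<bar>)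
        - real n * katetov_defect n v (\<lambda>i j. w (i * Suc n + j)))))
     (map (\<lambda>q. Dist (q div Suc n) (q mod Suc n)) [0..<Suc n * Suc n])"

lemma wf_ext_fmla: "wf_fmla (ext_fmla n v)"
  unfolding ext_fmla_def wf_fmla.simps length_map length_upt katetov_defect_def
  by (auto intro!: connective_clamp continuous_intros continuous_map_coordinate
        pair_index_less simp del: mult_Suc mult_Suc_right)

lemma FV_ext_fmla: "FV (ext_fmla n v) \<subseteq> {..n}"
  unfolding ext_fmla_def
  by (auto simp: less_Suc_eq_le[symmetric] less_mult_imp_div_less simp del: mult_Suc mult_Suc_right)

lemma eval_ext_fmla:
  "eval (ext_fmla n v) z = min 1 (max 0 ((\<Sum>i<n. \<bar>dist (z n) (z i) - v i\<bar>)
     - real n * katetov_defect n v (\<lambda>i j. dist (z i) (z j))))"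
proof -
  define w where "w = (\<lambda>i\<in>{..<Suc n * Suc n}. dist (z (i div Suc n)) (z (i mod Suc n)))"
  have w: "w (i * Suc n + j) = dist (z i) (z j)" if "i \<le> n" "j \<le> n" for i j
  proof -
    have "i * Suc n + j < Suc n * Suc n" using that by (rule pair_index_less)
    moreover have "(i * Suc n + j) div Suc n = i" "(i * Suc n + j) mod Suc n = j"
      using that by (auto simp del: mult_Suc mult_Suc_right simp: div_add1_eq)
    ultimately show ?thesis by (simp only: w_def restrict_apply lessThan_iff if_True)
  qed
  have "(\<lambda>i\<in>{..<Suc n * Suc n}.
      map (\<lambda>\<phi>. eval \<phi> z) (map (\<lambda>q. Dist (q div Suc n) (q mod Suc n)) [0..<Suc n * Suc n]) ! i) = w"
    unfolding w_def by (rule restrict_ext) (simp del: mult_Suc mult_Suc_right upt_Suc)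
  then have "eval (ext_fmla n v) z = min 1 (max 0 ((\<Sum>i<n. \<bar>w (n * Suc n + i) - v i\<bar>)
      - real n * katetov_defect n v (\<lambda>i j. w (i * Suc n + j))))"
    unfolding ext_fmla_def eval.simps length_map length_upt by (simp only: diff_zero)
  also have "(\<Sum>i<n. \<bar>w (n * Suc n + i) - v i\<bar>) = (\<Sum>i<n. \<bar>dist (z n) (z i) - v i\<bar>)"
    by (rule sum.cong[OF refl], subst w) auto
  also have "katetov_defect n v (\<lambda>i j. w (i * Suc n + j)) = katetov_defect n v (\<lambda>i j. dist (z i) (z j))"
    unfolding katetov_defect_def
    by (rule sum.cong[OF refl], rule sum.cong[OF refl], subst w, simp, simp, subst w, simp_all)
  finally show ?thesis .
qed

text \<open>The point from \<open>urysohn_sphere_approx_one_point\<close> makes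
  \<open>ext_fmla\<close> exactly zero, whatever the tuple. The \<open>SupQ\<close> prefix binds the
  tuple, as \<open>Th\<close> contains only sentences.\<close>

lemma ext_sentence_in_Th:
  assumes U: "urysohn_sphere TYPE('u::complete_space)" and v: "\<And>i. i < n \<Longrightarrow> 0 \<le> v i \<and> v i \<le> 1"
  shows "foldr SupQ [0..<n] (InfQ n (ext_fmla n v)) \<in> Th TYPE('u)"
proof -
  have M: "metric_structure TYPE('u)"
    using urysohn_sphere_dist_le_1[OF U] by (simp add: metric_structure_def)
  have wf: "wf_fmla (InfQ n (ext_fmla n v))" using wf_ext_fmla by simp
  have "\<exists>m. eval (ext_fmla n v) (z(n := m)) < \<epsilon>" if "\<epsilon> > 0" for z :: "nat \<Rightarrow> 'u" and \<epsilon>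
  proof -
    obtain m where m: "\<forall>i<n. \<bar>dist m (z i) - v i\<bar> \<le> katetov_defect n v (\<lambda>i j. dist (z i) (z j))"
      using urysohn_sphere_approx_one_point[OF U, of n v z] v by blast
    have "(\<Sum>i<n. \<bar>dist m (z i) - v i\<bar>) \<le> (\<Sum>i<n. katetov_defect n v (\<lambda>i j. dist (z i) (z j)))"
      using m by (intro sum_mono) auto
    moreover have "katetov_defect n v (\<lambda>i j. dist ((z(n := m)) i) ((z(n := m)) j))
        = katetov_defect n v (\<lambda>i j. dist (z i) (z j))"
      unfolding katetov_defect_def by (intro sum.cong refl) auto
    ultimately have "eval (ext_fmla n v) (z(n := m)) = 0" unfolding eval_ext_fmla by simp
    then show ?thesis using that by metis
  qed
  then have "satisfies TYPE('u) (InfQ n (ext_fmla n v))"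
    unfolding satisfies_InfQ_iff[OF M wf_ext_fmla] by blast
  moreover have "FV (foldr SupQ [0..<n] (InfQ n (ext_fmla n v))) = {}"
  proof -
    have "{..n} = {n} \<union> {..<n}" by auto
    then show ?thesis using FV_ext_fmla[of n v] unfolding FV_foldr_SupQ by fastforce
  qed
  ultimately show ?thesis
    using satisfies_foldr_SupQ_iff[OF M wf, of "[0..<n]"] unfolding Th_def sentence_def by blast
qed

lemma model_approx_one_point:
  fixes R :: "('m::complete_space \<times> real) set"
  assumes U: "urysohn_sphere TYPE('u::complete_space)"
    and M: "is_model TYPE('m) (Th TYPE('u))"
    and fin: "finite R" and R: "katetov R" and \<epsilon>: "\<epsilon> > 0"
  shows "\<exists>m. \<forall>(p, v)\<in>R. \<bar>dist m p - v\<bar> < \<epsilon>"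
proof -
  obtain n r where r: "R = r ` {..<n::nat}"
    using finite_imp_nat_seg_image_inj_on[OF fin] by (auto simp: lessThan_def)
  define z where "z = fst \<circ> r"
  define v where "v = snd \<circ> r"
  have zv: "(z i, v i) \<in> R" if "i < n" for i using that r by (auto simp: z_def v_def)
  have v: "0 \<le> v i \<and> v i \<le> 1" if "i < n" for i
    using zv[OF that] katetov_ge_0[OF R] katetov_le_1[OF R] by blast
  have ms: "metric_structure TYPE('m)" using M by (simp add: is_model_def)
  have wf: "wf_fmla (InfQ n (ext_fmla n v))" using wf_ext_fmla by simp
  have "satisfies TYPE('m) (InfQ n (ext_fmla n v))"
    using ext_sentence_in_Th[OF U, of n v] v M satisfies_foldr_SupQ_iff[OF ms wf, of "[0..<n]"]
    by (auto simp: is_model_def)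
  then have "\<forall>(w :: nat \<Rightarrow> 'm) \<epsilon>. \<epsilon> > 0 \<longrightarrow> (\<exists>m. eval (ext_fmla n v) (w(n := m)) < \<epsilon>)"
    unfolding satisfies_InfQ_iff[OF ms wf_ext_fmla] .
  \<comment> \<open>The bound 1 is imposed along with \<open>\<epsilon>\<close> because a value
    below 1 has not been cut off by the clamp: it controls the true error sum.\<close>
  then obtain m where m: "eval (ext_fmla n v) (z(n := m)) < min \<epsilon> 1"
    using \<epsilon> by (meson min_less_iff_conj zero_less_one)
  have "katetov_defect n v (\<lambda>i j. dist ((z(n := m)) i) ((z(n := m)) j)) = 0"
    unfolding katetov_defect_def
  proof (intro sum.neutral ballI)
    fix i j assume "i \<in> {..<n}" "j \<in> {..<n}"
    then show "max 0 (\<bar>v i - v j\<bar> - dist ((z(n := m)) i) ((z(n := m)) j)) +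
        max 0 (dist ((z(n := m)) i) ((z(n := m)) j) - v i - v j) = 0"
      using katetovD[OF R zv[of i] zv[of j]] by auto
  qed
  then have "eval (ext_fmla n v) (z(n := m)) = min 1 (max 0 (\<Sum>i<n. \<bar>dist m (z i) - v i\<bar>))"
    unfolding eval_ext_fmla by simp
  then have less: "(\<Sum>i<n. \<bar>dist m (z i) - v i\<bar>) < \<epsilon>"
    using m by linarith
  have "\<bar>dist m (z i) - v i\<bar> < \<epsilon>" if "i < n" for i
  proof -
    have "\<bar>dist m (z i) - v i\<bar> \<le> (\<Sum>i<n. \<bar>dist m (z i) - v i\<bar>)"
      using that by (intro member_le_sum) auto
    then show ?thesis using less by linarith
  qed
  then have "\<forall>t\<in>R. \<bar>dist m (fst t) - snd t\<bar> < \<epsilon>" unfolding r z_def v_def by simp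
  then show ?thesis by (intro exI[of _ m]) auto
qed

section \<open>Exact extension over small sets in the monster model\<close>

context includes cardinal_syntax
begin

text \<open>Only the cardinality of \<open>P\<close> matters. Bounding the domain by cardinality
  instead of inclusion lets the property pass from a set to its images, which the recursive
  construction of copies requires.\<close>

definition extends_over :: "'m::complete_space set \<Rightarrow> bool" where
  "extends_over P \<longleftrightarrow>
     (\<forall>R. katetov R \<and> |fst ` R| \<le>o |P| \<longrightarrow> (\<exists>m :: 'm. \<forall>(p, v)\<in>R. dist m p = v))"

lemma extends_overD:
  assumes "extends_over (fst ` R)" "katetov R"
  shows "\<exists>m. \<forall>(p, v)\<in>R. dist m p = v"
  using assms ordLeq_refl[OF card_of_Card_order] unfolding extends_over_def by blast

lemma extends_over_mono:
  fixes P Q :: "'m::complete_space set"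
  assumes Q: "extends_over Q" and PQ: "|P| \<le>o |Q|"
  shows "extends_over P"
  unfolding extends_over_def
proof (intro allI impI)
  fix R :: "('m \<times> real) set"
  assume R: "katetov R \<and> |fst ` R| \<le>o |P|"
  then have "|fst ` R| \<le>o |Q|" using PQ by (blast intro: ordLeq_transitive)
  then show "\<exists>m. \<forall>(p, v)\<in>R. dist m p = v" using Q R unfolding extends_over_def by blast
qed

text \<open>Every finite part has approximate solutions, so saturation solves all approximate
  conditions simultaneously, hence the exact ones.\<close>

lemma saturated_imp_extends_over:
  fixes P :: "'m::complete_space set"
  assumes U: "urysohn_sphere TYPE('u::complete_space)"
    and M: "is_model TYPE('m) (Th TYPE('u))"
    and sat: "saturated TYPE('m) (cardSuc \<kappa>)" and \<kappa>: "Card_order \<kappa>" and P: "|P| \<le>o \<kappa>"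
  shows "extends_over P"
  unfolding extends_over_def
proof (intro allI impI)
  fix R :: "('m \<times> real) set"
  assume "katetov R \<and> |fst ` R| \<le>o |P|"
  then have R: "katetov R" and "|fst ` R| \<le>o \<kappa>" using P ordLeq_transitive by blast+
  then have card: "|fst ` R| <o cardSuc \<kappa>"
    using cardSuc_ordLeq_ordLess[OF \<kappa> card_of_Card_order] by blast
  \<comment> \<open>Saturation asks that finite subsets be realised exactly, whereas
    \<open>model_approx_one_point\<close> gives only approximations; hence conditions with tolerance
    \<open>1 / Suc k\<close> in place of \<open>dist = v\<close>.\<close>
  define near :: "real \<Rightarrow> nat \<Rightarrow> (nat + nat) fmla" where
    "near v k = Conn (\<lambda>w. min 1 (max 0 (\<bar>w 0 - v\<bar> - 1 / Suc k))) [Dist (Inl 0) (Inr 0)]" for v k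
  define cond :: "('m \<times> real) \<times> nat \<Rightarrow> (nat, 'm) pfmla" where
    "cond = (\<lambda>((p, v), k). (near v k, \<lambda>_. p))"
  have wf: "wf_fmla (near v k)" for v k
    unfolding near_def by (auto intro!: connective_clamp continuous_intros continuous_map_coordinate)
  have pval: "pval (cond ((p, v), k)) a = min 1 (max 0 (\<bar>dist (a 0) p - v\<bar> - 1 / Suc k))" for p v k a
    by (simp add: pval_def cond_def near_def)
  have "\<exists>a. realizes a (cond ` (R \<times> UNIV))"
  proof (rule sat[unfolded saturated_def, rule_format, OF card])
    show "cond ` (R \<times> UNIV) \<subseteq> fmlas_over {..<1} (fst ` R)"
      using wf by (auto simp: fmlas_over_def cond_def near_def param_vars_def image_iff intro: bexI[rotated])
    fix \<Gamma> assume "\<Gamma> \<subseteq> cond ` (R \<times> UNIV)" "finite \<Gamma>"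
    then obtain T where T: "T \<subseteq> R \<times> UNIV" "finite T" "\<Gamma> = cond ` T"
      by (meson finite_subset_image)
    \<comment> \<open>Finitely many conditions have a smallest tolerance, so one approximate point
      for that tolerance meets them all.\<close>
    define N where "N = Max (snd ` T)"
    have "fst ` T \<subseteq> R" using T(1) by auto
    then have "finite (fst ` T)" "katetov (fst ` T)"
      using T(2) katetov_subset[OF R] by simp_all
    then obtain m where m: "\<forall>(p, v)\<in>fst ` T. \<bar>dist m p - v\<bar> < 1 / Suc N"
      using model_approx_one_point[OF U M, of "fst ` T" "1 / Suc N"] by auto
    have "pval (cond ((p, v), k)) (\<lambda>_. m) = 0" if "((p, v), k) \<in> T" for p v k
    proof -
      have "k \<le> N" unfolding N_def using that T(2) by (intro Max_ge) (auto simp: image_iff intro: bexI[rotated])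
      then have "1 / real (Suc N) \<le> 1 / real (Suc k)" by (intro divide_left_mono) auto
      moreover have "\<bar>dist m p - v\<bar> < 1 / Suc N" using m that by force
      ultimately show ?thesis unfolding pval by linarith
    qed
    then show "\<exists>a. realizes a \<Gamma>"
      using T(3) unfolding realizes_def by (intro exI[of _ "\<lambda>_. m"]) auto
  qed
  then obtain a where a: "realizes a (cond ` (R \<times> UNIV))" by blast
  have "dist (a 0) p = v" if "(p, v) \<in> R" for p v
  proof -
    have "\<bar>dist (a 0) p - v\<bar> \<le> inverse (Suc k)" for k
    proof -
      have "pval (cond ((p, v), k)) a = 0" using a that by (auto simp: realizes_def)
      then have "\<bar>dist (a 0) p - v\<bar> \<le> 1 / Suc k" unfolding pval by linarith
      then show ?thesis by (simp add: inverse_eq_divide)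
    qed
    then have "\<not> 0 < \<bar>dist (a 0) p - v\<bar>"
      using reals_Archimedean[of "\<bar>dist (a 0) p - v\<bar>"] by (metis not_le)
    then show ?thesis by simp
  qed
  then show "\<exists>m. \<forall>(p, v)\<in>R. dist m p = v" by blast
qed

lemma monster_extends_over_countable:
  fixes P :: "'m::complete_space set"
  assumes U: "urysohn_sphere TYPE('u::complete_space)"
    and M: "monster_model TYPE('m) (Th TYPE('u))" and P: "countable P"
  shows "extends_over P"
  using saturated_imp_extends_over[OF U, of natLeq P] M P natLeq_Card_order
  by (auto simp: monster_model_def countable_card_le_natLeq)

text \<open>Smallness speaks of the density character, not the cardinality, so the extension
  property is derived for a dense subset.\<close>

lemma small_obtains_dense:
  fixes A :: "'m::complete_space set"
  assumes U: "urysohn_sphere TYPE('u::complete_space)"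
    and M: "monster_model TYPE('m) (Th TYPE('u))" and A: "small A"
  obtains D where "dense_in D A" "extends_over D"
proof -
  \<comment> \<open>Cardinals are well-ordered, so a dense subset of least cardinality exists and
    the choice in \<open>density_character\<close> really yields a dense set.\<close>
  have "\<exists>r\<in>card_of ` {D. dense_in D A}. \<forall>r'\<in>card_of ` {D. dense_in D A}. r \<le>o r'"
  proof (rule exists_minim_Card_order)
    have "dense_in A A" by (simp add: dense_in_def closure_subset)
    then show "card_of ` {D. dense_in D A} \<noteq> {}" by blast
  qed (auto simp: card_of_Card_order)
  then have ex: "\<exists>D. dense_in D A \<and> (\<forall>E. dense_in E A \<longrightarrow> |D| \<le>o |E| )" by blast
  define D where "D = (SOME D. dense_in D A \<and> (\<forall>E. dense_in E A \<longrightarrow> |D| \<le>o |E| ))"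
  have "dense_in D A" unfolding D_def using someI_ex[OF ex] by blast
  moreover have "extends_over D"
  proof (rule saturated_imp_extends_over[OF U])
    show "is_model TYPE('m) (Th TYPE('u))" using M by (simp add: monster_model_def)
    show "saturated TYPE('m) (cardSuc |D| )"
      using A unfolding small_def density_character_def D_def .
    show "Card_order |D|" by (rule card_of_Card_order)
    show "|D| \<le>o |D|" by (rule ordLeq_refl[OF card_of_Card_order])
  qed
  ultimately show thesis by (rule that)
qed

lemma extends_over_Un:
  assumes fin: "\<And>P :: 'm::complete_space set. finite P \<Longrightarrow> extends_over P"
    and X: "extends_over (X :: 'm set)" and Y: "extends_over Y"
  shows "extends_over (X \<union> Y)"
proof (cases "finite (X \<union> Y)")
  case False
  have aux: "|X \<union> Y| \<le>o |X|" if "|Y| \<le>o |X|" "infinite X" for X Y :: "'m set"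
    using that card_of_Un_ordLeq_infinite_Field[OF _ ordLeq_refl[OF card_of_Card_order] that(1) card_of_Card_order]
    by (simp add: Field_card_of)
  show ?thesis
  proof (cases "|Y| \<le>o |X|")
    case True
    then have "infinite X" using False card_of_ordLeq_finite by blast
    then show ?thesis using aux[OF True] X extends_over_mono by blast
  next
    case False': False
    then have XY: "|X| \<le>o |Y|" using ordLeq_total[OF card_of_Well_order card_of_Well_order] by blast
    then have "infinite Y" using False card_of_ordLeq_finite by blast
    then show ?thesis using aux[OF XY] Y extends_over_mono by (metis Un_commute)
  qed
qed (rule fin)

end

section \<open>Quantifier elimination\<close>

lemma finite_FV: "finite (FV \<phi>)"
  by (induction \<phi>) auto

text \<open>The back-and-forth step: the distances from a witness \<open>m\<close> to the tuple
  \<open>v\<close> form a Katetov function on the isometric tuple \<open>w\<close>, so a matching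
  witness \<open>m'\<close> exists there, and the induction hypothesis equates the values.\<close>

lemma quantifier_range_subset:
  fixes v w :: "'v \<Rightarrow> 'm::complete_space"
  assumes ext: "\<And>P :: 'm set. finite P \<Longrightarrow> extends_over P" and M: "metric_structure TYPE('m)"
    and IH: "\<And>(v :: 'v \<Rightarrow> 'm) (w :: 'v \<Rightarrow> 'm). (\<And>a b. a \<in> FV \<phi> \<Longrightarrow> b \<in> FV \<phi> \<Longrightarrow> dist (v a) (v b) = dist (w a) (w b)) \<Longrightarrow>
      eval \<phi> v = eval \<phi> w"
    and vw: "\<And>a b. a \<in> FV \<phi> - {x} \<Longrightarrow> b \<in> FV \<phi> - {x} \<Longrightarrow> dist (v a) (v b) = dist (w a) (w b)"
  shows "range (\<lambda>m. eval \<phi> (v(x := m))) \<subseteq> range (\<lambda>m. eval \<phi> (w(x := m)))"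
proof
  fix t assume "t \<in> range (\<lambda>m. eval \<phi> (v(x := m)))"
  then obtain m where t: "t = eval \<phi> (v(x := m))" by blast
  define R where "R = (\<lambda>y. (w y, dist m (v y))) ` (FV \<phi> - {x})"
  have "katetov R"
  proof (rule katetovI)
    fix p a assume "(p, a) \<in> R"
    then obtain y where y: "y \<in> FV \<phi> - {x}" "p = w y" "a = dist m (v y)" by (auto simp: R_def)
    show "a \<le> 1" using M y by (simp add: metric_structure_def)
    fix q b assume "(q, b) \<in> R"
    then obtain z where z: "z \<in> FV \<phi> - {x}" "q = w z" "b = dist m (v z)" by (auto simp: R_def)
    have "dist p q = dist (v y) (v z)" using vw[OF y(1) z(1)] y z by simp
    then show "a \<le> b + dist p q" "dist p q \<le> a + b"
      using y z dist_triangle[of m "v y" "v z"] dist_triangle[of "v y" "v z" m]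
      by (simp_all add: dist_commute)
  qed
  moreover have "finite (fst ` R)" using finite_FV[of \<phi>] by (simp add: R_def)
  ultimately obtain m' where m': "\<forall>(p, a)\<in>R. dist m' p = a" using extends_overD ext by blast
  have "eval \<phi> (v(x := m)) = eval \<phi> (w(x := m'))"
  proof (rule IH)
    fix a b assume "a \<in> FV \<phi>" "b \<in> FV \<phi>"
    then show "dist ((v(x := m)) a) ((v(x := m)) b) = dist ((w(x := m')) a) ((w(x := m')) b)"
      using m' vw by (auto simp: R_def dist_commute)
  qed
  then show "t \<in> range (\<lambda>m. eval \<phi> (w(x := m)))" using t by blast
qed

text \<open>Induction on the formula. At a quantifier both sides take the same set of values, by the
  previous inclusion in both directions, hence have equal suprema or infima.\<close>

lemma eval_isometric:
  fixes v w :: "'v \<Rightarrow> 'm::complete_space"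
  assumes ext: "\<And>P :: 'm set. finite P \<Longrightarrow> extends_over P" and M: "metric_structure TYPE('m)"
  shows "(\<And>x y. x \<in> FV \<phi> \<Longrightarrow> y \<in> FV \<phi> \<Longrightarrow> dist (v x) (v y) = dist (w x) (w y)) \<Longrightarrow>
    eval \<phi> v = eval \<phi> w"
proof (induction \<phi> arbitrary: v w)
  case (Dist x y)
  then show ?case by simp
next
  case (Conn u \<phi>s)
  have "eval \<phi> v = eval \<phi> w" if "\<phi> \<in> set \<phi>s" for \<phi>
    using that by (intro Conn.IH Conn.prems) auto
  then have "map (\<lambda>\<phi>. eval \<phi> v) \<phi>s = map (\<lambda>\<phi>. eval \<phi> w) \<phi>s" by simp
  then show ?case by (simp only: eval.simps)
next
  case (SupQ x \<phi>)
  have sub: "range (\<lambda>m. eval \<phi> (v(x := m))) \<subseteq> range (\<lambda>m. eval \<phi> (w(x := m)))"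
    if "\<And>a b. a \<in> FV \<phi> - {x} \<Longrightarrow> b \<in> FV \<phi> - {x} \<Longrightarrow> dist (v a) (v b) = dist (w a) (w b)"
    for v w :: "'v \<Rightarrow> 'm"
    by (rule quantifier_range_subset) (fact ext M SupQ.IH that)+
  have "range (\<lambda>m. eval \<phi> (v(x := m))) = range (\<lambda>m. eval \<phi> (w(x := m)))"
    using sub[of v w] sub[of w v] SupQ.prems by simp
  then show ?case by (simp only: eval.simps)
next
  case (InfQ x \<phi>)
  have sub: "range (\<lambda>m. eval \<phi> (v(x := m))) \<subseteq> range (\<lambda>m. eval \<phi> (w(x := m)))"
    if "\<And>a b. a \<in> FV \<phi> - {x} \<Longrightarrow> b \<in> FV \<phi> - {x} \<Longrightarrow> dist (v a) (v b) = dist (w a) (w b)"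
    for v w :: "'v \<Rightarrow> 'm"
    by (rule quantifier_range_subset) (fact ext M InfQ.IH that)+
  have "range (\<lambda>m. eval \<phi> (v(x := m))) = range (\<lambda>m. eval \<phi> (w(x := m)))"
    using sub[of v w] sub[of w v] InfQ.prems by simp
  then show ?case by (simp only: eval.simps)
qed

section \<open>Types correspond to isometry types\<close>

lemma pval_isometric:
  fixes f g :: "'i \<Rightarrow> 'm::complete_space"
  assumes ext: "\<And>P :: 'm set. finite P \<Longrightarrow> extends_over P" and M: "metric_structure TYPE('m)"
    and vars: "\<And>i. Inl i \<in> FV \<phi> \<Longrightarrow> i \<in> I"
    and ff: "\<And>i j. i \<in> I \<Longrightarrow> j \<in> I \<Longrightarrow> dist (f i) (f j) = dist (g i) (g j)"
    and fb: "\<And>i n. i \<in> I \<Longrightarrow> n \<in> param_vars \<phi> \<Longrightarrow> dist (f i) (b n) = dist (g i) (c n)"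
    and bb: "\<And>m n. m \<in> param_vars \<phi> \<Longrightarrow> n \<in> param_vars \<phi> \<Longrightarrow> dist (b m) (b n) = dist (c m) (c n)"
  shows "pval (\<phi>, b) f = pval (\<phi>, c) g"
  unfolding pval_def fst_conv snd_conv
proof (rule eval_isometric[OF ext M])
  fix x y assume "x \<in> FV \<phi>" "y \<in> FV \<phi>"
  then show "dist (case_sum f b x) (case_sum f b y) = dist (case_sum g c x) (case_sum g c y)"
    using vars ff fb bb by (cases x; cases y) (auto simp: param_vars_def dist_commute)
qed

lemma pval_isometric_over:
  fixes f g :: "'i \<Rightarrow> 'm::complete_space"
  assumes ext: "\<And>P :: 'm set. finite P \<Longrightarrow> extends_over P" and M: "metric_structure TYPE('m)"
    and ff: "\<And>i j. i \<in> I \<Longrightarrow> j \<in> I \<Longrightarrow> dist (f i) (f j) = dist (g i) (g j)"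
    and fc: "\<And>i c. i \<in> I \<Longrightarrow> c \<in> C \<Longrightarrow> dist (f i) c = dist (g i) c"
    and \<psi>: "\<psi> \<in> fmlas_over I C"
  shows "pval \<psi> f = pval \<psi> g"
proof -
  obtain \<phi> b where \<psi>': "\<psi> = (\<phi>, b)" by (cases \<psi>)
  have vars: "\<And>i. Inl i \<in> FV \<phi> \<Longrightarrow> i \<in> I" and b: "\<And>n. n \<in> param_vars \<phi> \<Longrightarrow> b n \<in> C"
    using \<psi> unfolding \<psi>' fmlas_over_def by auto
  show ?thesis unfolding \<psi>'
    by (rule pval_isometric[OF ext M vars ff]) (simp_all add: fc b)
qed

lemma tp_isometric:
  fixes f g :: "'i \<Rightarrow> 'm::complete_space"
  assumes "\<And>P :: 'm set. finite P \<Longrightarrow> extends_over P" and "metric_structure TYPE('m)"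
    and "\<And>i j. i \<in> I \<Longrightarrow> j \<in> I \<Longrightarrow> dist (f i) (f j) = dist (g i) (g j)"
    and "\<And>i c. i \<in> I \<Longrightarrow> c \<in> C \<Longrightarrow> dist (f i) c = dist (g i) c"
  shows "tp I f C = tp I g C"
proof -
  have "pval \<psi> f = pval \<psi> g" if "\<psi> \<in> fmlas_over I C" for \<psi>
    by (rule pval_isometric_over[OF assms(1,2) _ _ that]) (simp_all add: assms(3,4))
  then show ?thesis unfolding tp_def by auto
qed

text \<open>Each distance is itself recorded in the type, by the condition that it differs from its
  actual value \<open>r\<close> by 0.\<close>

lemma tp_eq_imp_isometric:
  fixes f g :: "'i \<Rightarrow> 'm::complete_space"
  assumes tp: "tp I f C = tp I g C" and M: "metric_structure TYPE('m)"
  shows "i \<in> I \<Longrightarrow> j \<in> I \<Longrightarrow> dist (f i) (f j) = dist (g i) (g j)"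
    and "i \<in> I \<Longrightarrow> c \<in> C \<Longrightarrow> dist (f i) c = dist (g i) c"
proof -
  define eqd :: "'i + nat \<Rightarrow> 'i + nat \<Rightarrow> real \<Rightarrow> ('i + nat) fmla" where
    "eqd x y r = Conn (\<lambda>w. min 1 (max 0 \<bar>w 0 - r\<bar>)) [Dist x y]" for x y r
  have wf: "wf_fmla (eqd x y r)" for x y r
    unfolding eqd_def wf_fmla.simps
    by (intro conjI connective_clamp continuous_intros continuous_map_coordinate) auto
  have pval: "pval (eqd x y r, b) h = min 1 \<bar>dist (case_sum h b x) (case_sum h b y) - r\<bar>" for x y r b h
    by (simp add: pval_def eqd_def)
  {
    assume "i \<in> I" "j \<in> I"
    then have "(eqd (Inl i) (Inl j) (dist (g i) (g j)), undefined) \<in> tp I g C"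
      using wf by (auto simp: tp_def fmlas_over_def param_vars_def pval) (auto simp: eqd_def)
    then have "pval (eqd (Inl i) (Inl j) (dist (g i) (g j)), undefined) f = 0"
      unfolding tp[symmetric] by (simp add: tp_def)
    then show "dist (f i) (f j) = dist (g i) (g j)"
      unfolding pval by (simp add: min_def split: if_splits)
  next
    assume "i \<in> I" "c \<in> C"
    then have "(eqd (Inl i) (Inr 0) (dist (g i) c), \<lambda>_. c) \<in> tp I g C"
      using wf by (auto simp: tp_def fmlas_over_def param_vars_def pval) (auto simp: eqd_def)
    then have "pval (eqd (Inl i) (Inr 0) (dist (g i) c), \<lambda>_. c) f = 0"
      unfolding tp[symmetric] by (simp add: tp_def)
    then show "dist (f i) c = dist (g i) c"
      unfolding pval by (simp add: min_def split: if_splits)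
  }
qed

section \<open>Free amalgamation\<close>

text \<open>The largest distance that the triangle inequalities through \<open>C\<close> and the
  bound 1 permit. Inserting 1 imposes the diameter bound and keeps the set nonempty when
  \<open>C\<close> is empty.\<close>

definition free_dist :: "'m::metric_space set \<Rightarrow> 'm \<Rightarrow> 'm \<Rightarrow> real" where
  "free_dist C a e = Inf (insert 1 ((\<lambda>c. dist a c + dist c e) ` C))"

lemma free_dist_bdd: "bdd_below (insert 1 ((\<lambda>c. dist a c + dist c e) ` C))"
  by (rule bdd_belowI[of _ 0]) auto

lemma free_dist_le_1: "free_dist C a e \<le> 1"
  unfolding free_dist_def by (rule cInf_lower[OF _ free_dist_bdd]) simp

lemma free_dist_le: "c \<in> C \<Longrightarrow> free_dist C a e \<le> dist a c + dist c e"
  unfolding free_dist_def by (rule cInf_lower[OF _ free_dist_bdd]) simp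

lemma free_dist_greatest:
  "r \<le> 1 \<Longrightarrow> (\<And>c. c \<in> C \<Longrightarrow> r \<le> dist a c + dist c e) \<Longrightarrow> r \<le> free_dist C a e"
  unfolding free_dist_def by (rule cInf_greatest) auto

lemma free_dist_ge_0: "0 \<le> free_dist C a e"
  by (rule free_dist_greatest) auto

text \<open>Every path length \<open>dist a c + dist c e\<close> is 1-Lipschitz in \<open>a\<close>
  and in \<open>e\<close>, and so is an infimum of such functions. This serves both the Katetov
  inequalities and the passage to closures.\<close>

lemma free_dist_lipschitz:
  "free_dist C a e \<le> free_dist C a' e + dist a a'"
  "free_dist C a e \<le> free_dist C a e' + dist e e'"
proof -
  have "free_dist C a e - dist a a' \<le> free_dist C a' e"
  proof (rule free_dist_greatest)
    show "free_dist C a e - dist a a' \<le> 1"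
      using free_dist_le_1[of C a e] zero_le_dist[of a a'] by linarith
    fix c assume "c \<in> C"
    then show "free_dist C a e - dist a a' \<le> dist a' c + dist c e"
      using free_dist_le[of c C a e] dist_triangle[of a c a'] by linarith
  qed
  then show "free_dist C a e \<le> free_dist C a' e + dist a a'" by linarith
  have "free_dist C a e - dist e e' \<le> free_dist C a e'"
  proof (rule free_dist_greatest)
    show "free_dist C a e - dist e e' \<le> 1"
      using free_dist_le_1[of C a e] zero_le_dist[of e e'] by linarith
    fix c assume "c \<in> C"
    then show "free_dist C a e - dist e e' \<le> dist a c + dist c e'"
      using free_dist_le[of c C a e] dist_triangle[of c e e'] dist_commute[of e e'] by linarith
  qed
  then show "free_dist C a e \<le> free_dist C a e' + dist e e'" by linarith
qed

lemma continuous_on_free_dist: "continuous_on S (\<lambda>a. free_dist C a e)" "continuous_on S (\<lambda>e. free_dist C a e)"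
proof -
  have cont: "continuous_on S f" if "\<And>x y. f x \<le> f y + dist x y" for f :: "'b::metric_space \<Rightarrow> real" and S
  proof -
    have "dist (f x) (f y) \<le> dist x y" for x y
      using that[of x y] that[of y x] dist_commute[of x y] by (simp add: dist_real_def abs_le_iff)
    then show ?thesis
      by (metis continuous_on_iff order_le_less_trans)
  qed
  show "continuous_on S (\<lambda>a. free_dist C a e)" "continuous_on S (\<lambda>e. free_dist C a e)"
    by (auto intro!: cont free_dist_lipschitz)
qed

text \<open>The path through \<open>c = e\<close> has length \<open>dist a e\<close>. Thus an
  isometric free copy keeps its distances to \<open>C\<close> and hence its type over
  \<open>C\<close>.\<close>

lemma free_dist_eq_dist:
  assumes M: "metric_structure TYPE('m::complete_space)" and e: "e \<in> C"
  shows "free_dist C a e = dist a (e :: 'm)"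
proof (rule antisym)
  show "free_dist C a e \<le> dist a e" using free_dist_le[OF e, of a e] by simp
  show "dist a e \<le> free_dist C a e"
    using M by (intro free_dist_greatest) (auto simp: metric_structure_def dist_triangle)
qed

text \<open>Two paths through \<open>C\<close> laid end to end cannot be shorter than the distance
  of their outer ends, and a term 1 dominates every distance.\<close>

lemma free_dist_triangle:
  fixes a e :: "'m::complete_space"
  assumes M: "metric_structure TYPE('m)"
  shows "dist e e' \<le> free_dist C a e + free_dist C a e'"
    and "dist a a' \<le> free_dist C a e + free_dist C a' e"
proof -
  have le1: "dist x y \<le> 1" for x y :: 'm using M by (simp add: metric_structure_def)
  \<comment> \<open>Both claims bound a sum of two infima from below: it suffices to bound each sum
    of two paths, while \<open>r \<le> 1\<close> covers the inserted 1s.\<close>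
  have gen: "r \<le> free_dist C a e + free_dist C a' e'"
    if "r \<le> 1" "\<And>c c'. c \<in> C \<Longrightarrow> c' \<in> C \<Longrightarrow> r \<le> dist a c + dist c e + (dist a' c' + dist c' e')"
    for r and a e a' e' :: 'm
  proof -
    have "r - free_dist C a e \<le> free_dist C a' e'"
    proof (rule free_dist_greatest)
      show "r - free_dist C a e \<le> 1" using that(1) free_dist_ge_0[of C a e] by linarith
      fix c' assume c': "c' \<in> C"
      have "r - (dist a' c' + dist c' e') \<le> free_dist C a e"
      proof (rule free_dist_greatest)
        show "r - (dist a' c' + dist c' e') \<le> 1"
          using that(1) zero_le_dist[of a' c'] zero_le_dist[of c' e'] by linarith
      qed (use that(2) c' in force)
      then show "r - free_dist C a e \<le> dist a' c' + dist c' e'" by linarith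
    qed
    then show ?thesis by linarith
  qed
  show "dist e e' \<le> free_dist C a e + free_dist C a e'"
  proof (rule gen[OF le1])
    fix c c' :: 'm
    show "dist e e' \<le> dist a c + dist c e + (dist a c' + dist c' e')"
      using dist_triangle[of e e' c] dist_triangle[of c e' a] dist_triangle[of a e' c']
      by (simp add: dist_commute)
  qed
  show "dist a a' \<le> free_dist C a e + free_dist C a' e"
  proof (rule gen[OF le1])
    fix c c' :: 'm
    show "dist a a' \<le> dist a c + dist c e + (dist a' c' + dist c' e)"
      using dist_triangle[of a a' c] dist_triangle[of c a' e] dist_triangle[of e a' c']
      by (simp add: dist_commute)
  qed
qed

text \<open>Free distances see \<open>e\<close> only through its distances to \<open>C\<close>; this
  allows the conjugates \<open>bs l\<close> to replace \<open>b\<close> in the final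
  argument.\<close>

lemma free_dist_cong:
  "(\<And>c. c \<in> C \<Longrightarrow> dist c e = dist c e') \<Longrightarrow> free_dist C a e = free_dist C a e'"
  unfolding free_dist_def by (simp cong: image_cong)

text \<open>The points of \<open>D\<close> are placed one at a time along a well-order of the whole
  space; each new image is a one-point extension over the images already placed together with
  \<open>E\<close>.\<close>

lemma free_copy_of_dense:
  fixes D E C :: "'m::complete_space set"
  assumes ext: "\<And>P :: 'm set. finite P \<Longrightarrow> extends_over P" and M: "metric_structure TYPE('m)"
    and D: "extends_over D" and E: "extends_over E"
  shows "\<exists>f. (\<forall>x\<in>D. \<forall>y\<in>D. dist (f x) (f y) = dist x y) \<and> (\<forall>x\<in>D. \<forall>e\<in>E. dist (f x) e = free_dist C x e)"
proof -
  obtain r :: "'m rel" where r: "Well_order r" "Field r = UNIV" by (metis well_ordering)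
  define S where "S = r - Id"
  have wf: "wf S" using r(1) unfolding S_def well_order_on_def by (rule conjunct2)
  have tot: "(x, y) \<in> S \<or> (y, x) \<in> S" if "x \<noteq> y" for x y
    using r that by (auto simp: S_def well_order_on_def linear_order_on_def total_on_def)
  define Q where "Q f x m \<longleftrightarrow> (\<forall>y\<in>D. (y, x) \<in> S \<longrightarrow> dist m (f y) = dist x y) \<and>
    (\<forall>e\<in>E. dist m e = free_dist C x e)" for f :: "'m \<Rightarrow> 'm" and x m
  have "\<exists>f. \<forall>x. x \<in> D \<longrightarrow> Q f x (f x)"
  proof (rule dependent_wf_choice[where P = "\<lambda>f x m. x \<in> D \<longrightarrow> Q f x m", OF wf])
    fix f g :: "'m \<Rightarrow> 'm" and x m
    assume "\<And>z. (z, x) \<in> S \<Longrightarrow> f z = g z"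
    then show "(x \<in> D \<longrightarrow> Q f x m) = (x \<in> D \<longrightarrow> Q g x m)" by (auto simp: Q_def)
  next
    fix x f assume IH: "\<And>y. (y, x) \<in> S \<Longrightarrow> y \<in> D \<longrightarrow> Q f y (f y)"
    define L where "L = {y \<in> D. (y, x) \<in> S}"
    define R where "R = (\<lambda>y. (f y, dist x y)) ` L \<union> (\<lambda>e. (e, free_dist C x e)) ` E"
    have fe: "dist (f y) e = free_dist C y e" if "y \<in> L" "e \<in> E" for y e
      using IH[of y] that by (auto simp: L_def Q_def)
    have ff: "dist (f y) (f z) = dist y z" if "y \<in> L" "z \<in> L" for y z
    proof (cases "y = z")
      case False
      then show ?thesis
        using tot[OF False] IH[of y] IH[of z] that by (auto simp: L_def Q_def dist_commute)
    qed simp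
    have le1: "dist x y \<le> 1" for x y :: 'm using M by (simp add: metric_structure_def)
    \<comment> \<open>For two earlier images these are triangle inequalities with \<open>x\<close>;
      mixed pairs and pairs from \<open>E\<close> use \<open>free_dist_lipschitz\<close> and
      \<open>free_dist_triangle\<close>.\<close>
    have "katetov R"
    proof (rule katetovI)
      fix p v assume p: "(p, v) \<in> R"
      then show "v \<le> 1" using le1 free_dist_le_1 by (auto simp: R_def)
      fix q w assume q: "(q, w) \<in> R"
      from p consider (L) y where "y \<in> L" "p = f y" "v = dist x y" | (E) "p \<in> E" "v = free_dist C x p"
        unfolding R_def by auto
      note pcase = this
      from q consider (L) y where "y \<in> L" "q = f y" "w = dist x y" | (E) "q \<in> E" "w = free_dist C x q"
        unfolding R_def by auto
      note qcase = this
      show "v \<le> w + dist p q"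
      proof (cases rule: pcase)
        case (L y)
        note y = L
        show ?thesis
        proof (cases rule: qcase)
          case (L z)
          then show ?thesis using y ff[of y z] dist_triangle[of x y z] by (simp add: dist_commute)
        next
          case E
          then show ?thesis using y fe[of y q] free_dist_triangle(2)[OF M, of x y C q] by simp
        qed
      next
        case E
        note e = E
        show ?thesis
        proof (cases rule: qcase)
          case (L z)
          then show ?thesis using e fe[of z p] free_dist_lipschitz(1)[of C x p z] by (simp add: dist_commute)
        next
          case E
          then show ?thesis using e free_dist_lipschitz(2)[of C x p q] by simp
        qed
      qed
      show "dist p q \<le> v + w"
      proof (cases rule: pcase)
        case (L y)
        note y = L
        show ?thesis
        proof (cases rule: qcase)
          case (L z)
          then show ?thesis using y ff[of y z] dist_triangle[of y z x] by (simp add: dist_commute)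
        next
          case E
          then show ?thesis using y fe[of y q] free_dist_lipschitz(1)[of C y q x] by (simp add: dist_commute)
        qed
      next
        case E
        note e = E
        show ?thesis
        proof (cases rule: qcase)
          case (L z)
          then show ?thesis using e fe[of z p] free_dist_lipschitz(1)[of C z p x] by (simp add: dist_commute)
        next
          case E
          then show ?thesis using e free_dist_triangle(1)[OF M, of p q C x] by simp
        qed
      qed
    qed
    moreover have "extends_over (fst ` R)"
    proof -
      \<comment> \<open>The image of \<open>L\<close> need not lie in \<open>D\<close>, but it has
        at most as many points as \<open>D\<close>, which is all that \<open>extends_over\<close>
        needs.\<close>
      have "extends_over (f ` L)"
        using D by (rule extends_over_mono)
          (rule ordLeq_transitive[OF card_of_image card_of_mono1], simp add: L_def)
      then have "extends_over (f ` L \<union> E)" using extends_over_Un[OF ext _ E] by blast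
      moreover have "fst ` R = f ` L \<union> E" by (auto simp: R_def image_Un image_image)
      ultimately show ?thesis by simp
    qed
    ultimately obtain m where m: "\<forall>(p, v)\<in>R. dist m p = v" using extends_overD by blast
    have "dist m p = v" if "(p, v) \<in> R" for p v using bspec[OF m that] by simp
    then have "Q f x m" unfolding Q_def by (simp add: R_def L_def)
    then show "\<exists>m. x \<in> D \<longrightarrow> Q f x m" by blast
  qed
  then obtain f where f: "\<And>x. x \<in> D \<Longrightarrow> Q f x (f x)" by blast
  have "dist (f x) (f y) = dist x y" if "x \<in> D" "y \<in> D" for x y
    using tot[of x y] f[OF that(1)] f[OF that(2)] that by (cases "x = y") (auto simp: Q_def dist_commute)
  moreover have "dist (f x) e = free_dist C x e" if "x \<in> D" "e \<in> E" for x e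
    using f[OF that(1)] that(2) by (simp add: Q_def)
  ultimately show ?thesis by blast
qed

text \<open>\<open>f0\<close> is isometric on \<open>D\<close>, hence uniformly continuous, and
  extends to the closure by completeness. The two families of equations are closed conditions and
  pass to closures one argument at a time.\<close>

lemma free_copy:
  fixes A B C :: "'m::complete_space set"
  assumes ext: "\<And>P :: 'm set. finite P \<Longrightarrow> extends_over P" and M: "metric_structure TYPE('m)"
    and DA: "extends_over D" "A \<subseteq> closure D" and E: "extends_over E" "B \<subseteq> closure E"
  shows "\<exists>f. (\<forall>x\<in>A. \<forall>y\<in>A. dist (f x) (f y) = dist x y) \<and> (\<forall>x\<in>A. \<forall>e\<in>B. dist (f x) e = free_dist C x e)"
proof -
  obtain f0 where f0: "\<forall>x\<in>D. \<forall>y\<in>D. dist (f0 x) (f0 y) = dist x y"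
      "\<forall>x\<in>D. \<forall>e\<in>E. dist (f0 x) e = free_dist C x e"
    using free_copy_of_dense[OF ext M DA(1) E(1)] by blast
  have "uniformly_continuous_on D f0"
    unfolding uniformly_continuous_on_def using f0(1) by auto
  then obtain f where f: "uniformly_continuous_on (closure D) f" "\<And>x. x \<in> D \<Longrightarrow> f0 x = f x"
    using uniformly_continuous_on_extension_on_closure by metis
  have cont: "continuous_on (closure D) f" using f(1) by (rule uniformly_continuous_imp_continuous)
  have ff1: "dist (f x) (f y) - dist x y = 0" if "x \<in> closure D" "y \<in> D" for x y
    by (rule continuous_constant_on_closure[OF _ _ that(1)])
      (use f f0 that in \<open>auto intro!: continuous_intros cont\<close>)
  have ff: "dist (f x) (f y) - dist x y = 0" if "x \<in> closure D" "y \<in> closure D" for x y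
    by (rule continuous_constant_on_closure[OF _ _ that(2)])
      (use ff1[OF that(1)] in \<open>auto intro!: continuous_intros cont\<close>)
  have fe1: "dist (f x) e - free_dist C x e = 0" if "x \<in> closure D" "e \<in> E" for x e
    by (rule continuous_constant_on_closure[OF _ _ that(1)])
      (use f f0 that in \<open>auto intro!: continuous_intros cont continuous_on_free_dist\<close>)
  have fe: "dist (f x) e - free_dist C x e = 0" if "x \<in> closure D" "e \<in> closure E" for x e
    by (rule continuous_constant_on_closure[OF _ _ that(2)])
      (use fe1[OF that(1)] in \<open>auto intro!: continuous_intros cont continuous_on_free_dist\<close>)
  show ?thesis using ff fe DA(2) E(2) by (intro exI[of _ f]) (simp add: subset_iff)
qed

section \<open>Free copies do not divide\<close>

theorem theorem3p20:
  fixes A B C :: "'m::complete_space set" and b_star :: 'm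
  assumes "urysohn_sphere TYPE('u::complete_space)"
    and "monster_model TYPE('m) (Th TYPE('u))"
    and "small B" and "small C" and "small A"
    and "d_indep A C B"
  shows "\<exists>A'. equiv_over C A' A \<and> d_indep A' C (insert b_star B)"
proof -
  note U = assms(1) and MM = assms(2)
  have M: "metric_structure TYPE('m)" using MM by (simp add: monster_model_def is_model_def)
  have ext: "extends_over P" if "finite P" for P :: "'m set"
    using monster_extends_over_countable[OF U MM countable_finite[OF that]] .
  obtain DA where DA: "dense_in DA A" "extends_over DA" using small_obtains_dense[OF U MM assms(5)] .
  obtain DB where DB: "dense_in DB B" "extends_over DB" using small_obtains_dense[OF U MM assms(3)] .
  obtain DC where DC: "dense_in DC C" "extends_over DC" using small_obtains_dense[OF U MM assms(4)] .
  define B' where "B' = insert b_star B"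
  \<comment> \<open>\<open>P\<close> leaves room for finitely many further parameters: adding
    \<open>P\<close> and \<open>b_star\<close> to the dense sets preserves the extension
    property.\<close>
  have copy: "\<exists>f. (\<forall>x\<in>A. \<forall>y\<in>A. dist (f x) (f y) = dist x y) \<and>
      (\<forall>x\<in>A. \<forall>e\<in>B' \<union> C \<union> P. dist (f x) e = free_dist C x e)" if P: "finite P" for P
  proof (rule free_copy[OF ext M DA(2)])
    show "A \<subseteq> closure DA" using DA(1) by (simp add: dense_in_def)
    show "extends_over (DB \<union> DC \<union> insert b_star P)"
      using P by (intro extends_over_Un DB DC ext) auto
    have "insert b_star P \<subseteq> closure (insert b_star P)" by (rule closure_subset)
    then show "B' \<union> C \<union> P \<subseteq> closure (DB \<union> DC \<union> insert b_star P)"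
      using DB(1) DC(1) unfolding dense_in_def B'_def closure_Un by blast
  qed
  obtain f where ff: "\<And>x y. x \<in> A \<Longrightarrow> y \<in> A \<Longrightarrow> dist (f x) (f y) = dist x y"
      and fe: "\<And>x e. x \<in> A \<Longrightarrow> e \<in> B' \<union> C \<Longrightarrow> dist (f x) e = free_dist C x e"
    using copy[of "{}"] by (metis finite.emptyI Un_empty_right)
  have "tp A f C = tp A (\<lambda>x. x) C"
    by (rule tp_isometric[OF ext M]) (simp_all add: ff fe free_dist_eq_dist[OF M])
  then have "equiv_over C (f ` A) A" unfolding equiv_over_def by blast
  moreover have "d_indep (f ` A) C B'"
    unfolding d_indep_def
  proof
    assume "divides_type (f ` A) C (tp (f ` A) (\<lambda>x. x) (B' \<union> C))"
    then obtain \<phi> b where \<phi>: "(\<phi>, b) \<in> fmlas_over (f ` A) UNIV" and div: "divides_fmla C (\<phi>, b)"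
      and force: "forces (tp (f ` A) (\<lambda>x. x) (B' \<union> C)) (\<phi>, b)"
      unfolding divides_type_def by (metis surj_pair)
    obtain bs :: "nat \<Rightarrow> nat \<Rightarrow> 'm" and \<epsilon> :: real and k :: nat where
      bs': "(\<forall>l. tp (param_vars \<phi>) (bs l) C = tp (param_vars \<phi>) b C) \<and> \<epsilon> > 0 \<and> k > 0 \<and>
        (\<forall>K. finite K \<and> card K = k \<longrightarrow>
           \<not> (\<exists>a. \<forall>l\<in>K. max (pval (\<phi>, bs l) a - \<epsilon>) 0 = 0))"
      using div unfolding divides_fmla_def prod.case by (elim exE) (rule that)
    then have bs: "tp (param_vars \<phi>) (bs l) C = tp (param_vars \<phi>) b C" and \<epsilon>: "\<epsilon> > 0" for l
      by simp_all
    have incons: "\<not> (\<exists>a. \<forall>l\<in>{..<k}. max (pval (\<phi>, bs l) a - \<epsilon>) 0 = 0)"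
      using bs' by (metis card_lessThan finite_lessThan)
    have vars: "i \<in> f ` A" if "Inl i \<in> FV \<phi>" for i using \<phi> that by (auto simp: fmlas_over_def)
    have fin: "finite (param_vars \<phi>)"
      unfolding param_vars_def using finite_vimageI[OF finite_FV[of \<phi>] inj_Inr] by (simp add: vimage_def)
    \<comment> \<open>The variables of the type are the points of the image of \<open>A\<close>
      under \<open>f\<close>, whereas the copies below are indexed by \<open>A\<close>;
      \<open>g\<close> translates.\<close>
    define g where "g = inv_into A f"
    have gA: "g i \<in> A" and fg: "f (g i) = i" if "i \<in> f ` A" for i
      using that unfolding g_def by (auto intro: inv_into_into f_inv_into_f)
    \<comment> \<open>\<open>f\<close> need not be free over \<open>b\<close>, so another copy is
      taken that is also free over the parameters of \<open>\<phi>\<close>. Having the same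
      distances over \<open>B' \<union> C\<close>, it realises the type and so satisfies the forced
      condition.\<close>
    obtain h where hh: "\<And>x y. x \<in> A \<Longrightarrow> y \<in> A \<Longrightarrow> dist (h x) (h y) = dist x y"
      and he: "\<And>x e. x \<in> A \<Longrightarrow> e \<in> B' \<union> C \<union> b ` param_vars \<phi> \<Longrightarrow> dist (h x) e = free_dist C x e"
      using copy[OF finite_imageI[OF fin]] by metis
    define P where "P = (\<Union>l<k. bs l ` param_vars \<phi>)"
    have finP: "finite P" using fin by (simp add: P_def)
    obtain h' where hh': "\<And>x y. x \<in> A \<Longrightarrow> y \<in> A \<Longrightarrow> dist (h' x) (h' y) = dist x y"
      and he': "\<And>x e. x \<in> A \<Longrightarrow> e \<in> B' \<union> C \<union> P \<Longrightarrow> dist (h' x) e = free_dist C x e"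
      using copy[OF finP] by metis
    have "realizes (\<lambda>i. h (g i)) (tp (f ` A) (\<lambda>x. x) (B' \<union> C))"
      unfolding realizes_def
    proof
      fix \<psi> assume \<psi>: "\<psi> \<in> tp (f ` A) (\<lambda>x. x) (B' \<union> C)"
      have "pval \<psi> (\<lambda>i. h (g i)) = pval \<psi> (\<lambda>x. x)"
      proof (rule pval_isometric_over[OF ext M])
        show "\<psi> \<in> fmlas_over (f ` A) (B' \<union> C)" using \<psi> by (simp add: tp_def)
        show "dist (h (g i)) (h (g j)) = dist i j" if "i \<in> f ` A" "j \<in> f ` A" for i j
          using ff[OF gA gA, OF that] hh[OF gA gA, OF that] fg that by simp
        show "dist (h (g i)) c = dist i c" if "i \<in> f ` A" "c \<in> B' \<union> C" for i c
          using fe[OF gA, OF that] he[OF gA[OF that(1)], of c] fg that by auto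
      qed
      then show "pval \<psi> (\<lambda>i. h (g i)) = 0" using \<psi> by (simp add: tp_def)
    qed
    then have zero: "pval (\<phi>, b) (\<lambda>i. h (g i)) = 0" using force unfolding forces_def by blast
    have "pval (\<phi>, bs l) (\<lambda>i. h' (g i)) = 0" if l: "l < k" for l
    proof -
      \<comment> \<open>By quantifier elimination equal distances are enough: \<open>h\<close> and
        \<open>h'\<close> are both isometric, \<open>bs l\<close> has the type of \<open>b\<close>
        over \<open>C\<close>, and free distances depend only on that type.\<close>
      have "pval (\<phi>, bs l) (\<lambda>i. h' (g i)) = pval (\<phi>, b) (\<lambda>i. h (g i))"
      proof (rule pval_isometric[OF ext M vars])
        show "dist (h' (g i)) (h' (g j)) = dist (h (g i)) (h (g j))" if "i \<in> f ` A" "j \<in> f ` A" for i j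
          using hh[OF gA gA, OF that] hh'[OF gA gA, OF that] by simp
        show "dist (h' (g i)) (bs l n) = dist (h (g i)) (b n)" if i: "i \<in> f ` A" and n: "n \<in> param_vars \<phi>" for i n
        proof -
          have "free_dist C (g i) (bs l n) = free_dist C (g i) (b n)"
            using tp_eq_imp_isometric(2)[OF bs M n] by (intro free_dist_cong) (simp add: dist_commute)
          moreover have "dist (h' (g i)) (bs l n) = free_dist C (g i) (bs l n)"
            using he'[OF gA[OF i], of "bs l n"] l n by (auto simp: P_def)
          moreover have "dist (h (g i)) (b n) = free_dist C (g i) (b n)"
            using he[OF gA[OF i], of "b n"] n by auto
          ultimately show ?thesis by simp
        qed
        show "dist (bs l m) (bs l n) = dist (b m) (b n)" if "m \<in> param_vars \<phi>" "n \<in> param_vars \<phi>" for m n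
          using tp_eq_imp_isometric(1)[OF bs M that] .
      qed
      then show ?thesis using zero by simp
    qed
    then have "\<forall>l\<in>{..<k}. max (pval (\<phi>, bs l) (\<lambda>i. h' (g i)) - \<epsilon>) 0 = 0"
      using \<epsilon> by simp
    then show False using incons by blast
  qed
  ultimately show ?thesis unfolding B'_def by blast
qed

end
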